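(* Let $n\ge 1$ and $d\ge 3$ be integers, let $f\in\mathbb{C}[x_1,\dots,x_n]$ be a form of degree $d$ that is smooth and diagonalizable, and suppose $P=(p_{ij})_{1\le i,j\le n}$ is an invertible complex matrix and $\alpha_1,\dots,\alpha_n\in\mathbb{C}$ are such that \[ f=\sum_{1\le i\le n}\alpha_i\Big(\sum_{1\le j\le n}p_{ij}x_j\Big)^d. \] Then $f$ is orthogonally (resp. unitarily) diagonalizable if and only if, after appropriate scaling of each row by a nonzero complex number, $P$ is orthogonal (resp. unitary).
   Context: The ground field is $\mathbb{C}$ and $d\ge 3$; a form is a homogeneous polynomial. A form $f\in\mathbb{C}[x_1,\dots,x_n]$ is smooth if the system $\frac{\partial f}{\partial x_1}=\cdots=\frac{\partial f}{\partial x_n}=0$ has no nonzero solution in $\mathbb{C}^n$. It is diagonalizable if $f=\sum_{i=1}^r\lambda_i\, l_i(x_1,\dots,x_n)^d$ with nonzero $\lambda_i\in\mathbb{C}$ and linearly independent linear forms $l_i$ over $\mathbb{C}$. A diagonalizable form is called orthogonally (resp. unitarily) diagonalizable if there is an orthogonal (resp. unitary) change of variables for the diagonalization, i.e. (for $f$ as in the claim) there exist an orthogonal (resp. unitary) matrix $Q=(q_{ij})\in\mathbb{C}^{n\times n}$ and $\lambda_1,\dots,\lambda_n\in\mathbb{C}$ with $f=\sum_{1\le i\le n}\lambda_i\big(\sum_{1\le j\le n}q_{ij}x_j\big)^d$. Here a complex matrix $Q$ is orthogonal if $Q^TQ=I_n$ and unitary if $\overline{Q}^TQ=I_n$. *)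

theory Defs
  imports "HOL-Analysis.Analysis" "HOL-Library.Poly_Mapping"
begin

(* The polynomial ring over the complex numbers in the variables x_j, j :: 'n: finitely
   supported functions from exponent vectors to coefficients, with the convolution product
   of Poly_Mapping. For a finite index type 'n with CARD('n) = n this is C[x_1, ..., x_n]. *)
type_synonym 'n cpoly = "('n \<Rightarrow>\<^sub>0 nat) \<Rightarrow>\<^sub>0 complex"

definition cconst :: "complex \<Rightarrow> 'n cpoly" where
  "cconst c = Poly_Mapping.single 0 c"

definition cvar :: "'n \<Rightarrow> 'n cpoly" where
  "cvar j = Poly_Mapping.single (Poly_Mapping.single j 1) 1"

definition ceval :: "('n::finite) cpoly \<Rightarrow> complex ^ 'n \<Rightarrow> complex" where
  "ceval f x = (\<Sum>m\<in>Poly_Mapping.keys f.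
     Poly_Mapping.lookup f m * (\<Prod>j\<in>UNIV. (x $ j) ^ Poly_Mapping.lookup m j))"

(* The exponent difference is truncated when x_j does not occur in the monomial m,
   but then the coefficient is 0; see lookup_partial below. *)
definition partial :: "'n \<Rightarrow> 'n cpoly \<Rightarrow> 'n cpoly" where
  "partial j f = (\<Sum>m\<in>Poly_Mapping.keys f.
     Poly_Mapping.single (m - Poly_Mapping.single j 1)
       (of_nat (Poly_Mapping.lookup m j) * Poly_Mapping.lookup f m))"

lemma lookup_partial:
  "Poly_Mapping.lookup (partial j f) m =
     of_nat (Poly_Mapping.lookup m j + 1) * Poly_Mapping.lookup f (m + Poly_Mapping.single j 1)"
proof -
  let ?e = "Poly_Mapping.single j (1::nat)"
  let ?g = "\<lambda>k. of_nat (Poly_Mapping.lookup k j) * Poly_Mapping.lookup f k"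
  have eq: "(?g k when k - ?e = m) = (?g k when k = m + ?e)" for k
  proof (cases "Poly_Mapping.lookup k j = 0")
    case False
    then have "k = (k - ?e) + ?e"
      by (intro poly_mapping_eqI) (auto simp: lookup_add lookup_minus lookup_single when_def)
    then have "k - ?e = m \<longleftrightarrow> k = m + ?e"
      by (metis add_diff_cancel_right')
    then show ?thesis by simp
  qed simp
  have "Poly_Mapping.lookup (partial j f) m =
      (\<Sum>k\<in>Poly_Mapping.keys f. ?g k when k - ?e = m)"
    by (simp add: partial_def lookup_sum lookup_single)
  also have "\<dots> = (\<Sum>k\<in>Poly_Mapping.keys f. if k = m + ?e then ?g k else 0)"
    unfolding eq by (simp add: when_def)
  also have "\<dots> = ?g (m + ?e)"
    by (simp add: sum.delta' sum.delta in_keys_iff)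
  finally show ?thesis
    by (simp add: lookup_add lookup_single)
qed

definition form :: "nat \<Rightarrow> ('n::finite) cpoly \<Rightarrow> bool" where
  "form d f \<longleftrightarrow> (\<forall>m\<in>Poly_Mapping.keys f. (\<Sum>j\<in>UNIV. Poly_Mapping.lookup m j) = d)"

definition smooth :: "('n::finite) cpoly \<Rightarrow> bool" where
  "smooth f \<longleftrightarrow> (\<forall>x :: complex ^ 'n. (\<forall>j. ceval (partial j f) x = 0) \<longrightarrow> x = 0)"

(* Independence of the family l 0, ..., l (r - 1); in particular, the l i are distinct. *)
definition lin_indep :: "nat \<Rightarrow> (nat \<Rightarrow> 'n cpoly) \<Rightarrow> bool" where
  "lin_indep r l \<longleftrightarrow>
     (\<forall>c. (\<Sum>i<r. cconst (c i) * l i) = 0 \<longrightarrow> (\<forall>i<r. c i = 0))"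

definition diagonalizable :: "nat \<Rightarrow> ('n::finite) cpoly \<Rightarrow> bool" where
  "diagonalizable d f \<longleftrightarrow>
     (\<exists>r (lam :: nat \<Rightarrow> complex) l.
        (\<forall>i<r. lam i \<noteq> 0) \<and> (\<forall>i<r. form 1 (l i)) \<and> lin_indep r l \<and>
        f = (\<Sum>i<r. cconst (lam i) * l i ^ d))"

definition diag_sum ::
  "nat \<Rightarrow> ('n::finite \<Rightarrow> complex) \<Rightarrow> complex ^ 'n ^ 'n \<Rightarrow> 'n cpoly" where
  "diag_sum d lam Q =
     (\<Sum>i\<in>UNIV. cconst (lam i) * (\<Sum>j\<in>UNIV. cconst (Q $ i $ j) * cvar j) ^ d)"

(* The library's orthogonal_matrix, over the complex numbers, is transpose Q ** Q = mat 1,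
   without complex conjugation. *)
lemma orthogonal_matrix_complex_iff:
  fixes Q :: "complex ^ 'n ^ 'n"
  shows "orthogonal_matrix Q \<longleftrightarrow> transpose Q ** Q = mat 1"
  by (metis matrix_left_right_inverse orthogonal_matrix_def)

definition unitary_matrix :: "complex ^ 'n ^ 'n \<Rightarrow> bool" where
  "unitary_matrix Q \<longleftrightarrow> transpose (map_matrix cnj Q) ** Q = mat 1"

definition orthogonally_diagonalizable :: "nat \<Rightarrow> ('n::finite) cpoly \<Rightarrow> bool" where
  "orthogonally_diagonalizable d f \<longleftrightarrow> diagonalizable d f \<and>
     (\<exists>Q lam. orthogonal_matrix Q \<and> f = diag_sum d lam Q)"

definition unitarily_diagonalizable :: "nat \<Rightarrow> ('n::finite) cpoly \<Rightarrow> bool" where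
  "unitarily_diagonalizable d f \<longleftrightarrow> diagonalizable d f \<and>
     (\<exists>Q lam. unitary_matrix Q \<and> f = diag_sum d lam Q)"

definition scale_rows :: "('n::finite \<Rightarrow> complex) \<Rightarrow> complex ^ 'n ^ 'n \<Rightarrow> complex ^ 'n ^ 'n" where
  "scale_rows c P = (\<chi> i j. c i * P $ i $ j)"

end

theory Submission
  imports Defs
begin

text \<open>If \<open>\<Sum>i. \<alpha> i * (P x)\<^sub>i ^ d = \<Sum>i. \<lambda> i * (Q x)\<^sub>i ^ d\<close> with \<open>P\<close> and \<open>Q\<close> invertible, substitute
  \<open>y = P x\<close> and put \<open>A = Q P\<^sup>-\<^sup>1\<close>. The left side has no mixed second derivatives in \<open>y\<close>, so
  \<open>\<Sum>i. \<lambda> i * A\<^sub>i\<^sub>j * A\<^sub>i\<^sub>k * (A y)\<^sub>i ^ (d - 2) = 0\<close> for \<open>j \<noteq> k\<close>. Since \<open>d \<ge> 3\<close>, choosing \<open>A y\<close> to be a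
  unit vector isolates a single summand, and as smoothness forces \<open>\<lambda> i \<noteq> 0\<close>, every row of \<open>A\<close> has
  exactly one nonzero entry. Hence \<open>Q\<close> is \<open>P\<close> up to a permutation and a scaling of the rows, and a
  permutation of the rows preserves both orthogonality and unitarity.\<close>

section \<open>Evaluation as a ring homomorphism\<close>

definition monom_eval :: "('n::finite \<Rightarrow>\<^sub>0 nat) \<Rightarrow> complex ^ 'n \<Rightarrow> complex" where
  "monom_eval m x = (\<Prod>j\<in>UNIV. (x $ j) ^ Poly_Mapping.lookup m j)"

lemma ceval_superset:
  assumes "finite S" "Poly_Mapping.keys f \<subseteq> S"
  shows "ceval f x = (\<Sum>m\<in>S. Poly_Mapping.lookup f m * monom_eval m x)"
  unfolding ceval_def monom_eval_def
  by (rule sum.mono_neutral_left) (use assms in \<open>auto simp: in_keys_iff\<close>)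

lemma ceval_single: "ceval (Poly_Mapping.single m c) x = c * monom_eval m x"
  by (subst ceval_superset[of "{m}"]) auto

lemma ceval_add: "ceval (f + g) x = ceval f x + ceval g x"
proof -
  let ?S = "Poly_Mapping.keys f \<union> Poly_Mapping.keys g"
  have "ceval h x = (\<Sum>m\<in>?S. Poly_Mapping.lookup h m * monom_eval m x)"
    if "h \<in> {f, g, f + g}" for h
    by (rule ceval_superset) (use that Poly_Mapping.keys_add[of f g] in auto)
  then show ?thesis
    by (simp add: lookup_add distrib_right sum.distrib)
qed

lemma ceval_0 [simp]: "ceval 0 x = 0"
  by (simp add: ceval_def)

lemma ceval_sum: "ceval (\<Sum>i\<in>I. f i) x = (\<Sum>i\<in>I. ceval (f i) x)"
  by (induction I rule: infinite_finite_induct) (auto simp: ceval_add)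

lemma monom_eval_add: "monom_eval (m + k) x = monom_eval m x * monom_eval k x"
  by (simp add: monom_eval_def lookup_add power_add prod.distrib)

lemma poly_mapping_sum_monomials:
  "(\<Sum>m\<in>Poly_Mapping.keys f. Poly_Mapping.single m (Poly_Mapping.lookup f m)) = f"
  by (rule poly_mapping_eqI) (simp add: lookup_sum lookup_single when_def in_keys_iff)

lemma ceval_mult: "ceval (f * g) x = ceval f x * ceval g x"
proof -
  \<comment> \<open>Writing both factors as sums of monomials reduces multiplicativity, by
    bilinearity, to \<open>monom_eval_add\<close>.\<close>
  let ?S = "\<lambda>h :: 'a cpoly. \<Sum>m\<in>Poly_Mapping.keys h. Poly_Mapping.single m (Poly_Mapping.lookup h m)"
  have "ceval (?S f * ?S g) x = ceval (?S f) x * ceval (?S g) x"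
    by (simp add: sum_product ceval_sum mult_single ceval_single monom_eval_add algebra_simps)
  then show ?thesis
    by (simp add: poly_mapping_sum_monomials)
qed

lemma ceval_const [simp]: "ceval (cconst c) x = c"
  by (simp add: cconst_def ceval_single monom_eval_def)

lemma ceval_var [simp]: "ceval (cvar j) x = x $ j"
proof -
  have "monom_eval (Poly_Mapping.single j 1) x = (\<Prod>k\<in>UNIV. if k = j then x $ j else 1)"
    unfolding monom_eval_def by (rule prod.cong) (auto simp: lookup_single)
  then show ?thesis
    by (simp add: cvar_def ceval_single)
qed

lemma ceval_power: "ceval (f ^ d) x = ceval f x ^ d"
proof (induction d)
  case 0
  have "(1 :: 'a cpoly) = cconst 1"
    by (simp add: cconst_def)
  then show ?case
    by (metis ceval_const power_0)
qed (simp add: ceval_mult)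

lemma ceval_diag_sum: "ceval (diag_sum d lam Q) x = (\<Sum>i\<in>UNIV. lam i * ((Q *v x) $ i) ^ d)"
  by (simp add: diag_sum_def ceval_sum ceval_mult ceval_power matrix_vector_mult_def)

section \<open>Derivatives along coordinate axes\<close>

text \<open>Links the formal \<open>partial\<close> to analysis: by uniqueness of derivatives, a
  gradient can be read off from any formula for the values of \<open>f\<close>.\<close>

lemma ceval_partial:
  "((\<lambda>s. ceval f (x + s *s axis k 1)) has_field_derivative ceval (partial k f) x) (at 0)"
proof -
  let ?l = Poly_Mapping.lookup
  have "((\<lambda>s. monom_eval m (x + s *s axis k 1)) has_field_derivative
      of_nat (?l m k) * monom_eval (m - Poly_Mapping.single k 1) x) (at 0)" for m
  proof -
    let ?R = "\<Prod>j\<in>UNIV - {k}. (x $ j) ^ ?l m j"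
    have 1: "monom_eval m (x + s *s axis k 1) = (x $ k + s) ^ ?l m k * ?R" for s
      unfolding monom_eval_def
      by (subst prod.remove[of _ k]) (auto simp: axis_def intro!: prod.cong)
    have 2: "monom_eval (m - Poly_Mapping.single k 1) x = (x $ k) ^ (?l m k - 1) * ?R"
      unfolding monom_eval_def
      by (subst prod.remove[of _ k]) (auto simp: lookup_minus lookup_single intro!: prod.cong)
    show ?thesis
      unfolding 1 2 by (auto intro!: derivative_eq_intros)
  qed
  then have "((\<lambda>s. \<Sum>m\<in>Poly_Mapping.keys f. ?l f m * monom_eval m (x + s *s axis k 1))
     has_field_derivative
      (\<Sum>m\<in>Poly_Mapping.keys f. ?l f m * (of_nat (?l m k) * monom_eval (m - Poly_Mapping.single k 1) x)))
     (at 0)"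
    by (intro DERIV_sum DERIV_cmult)
  then show ?thesis
    by (simp add: ceval_superset[OF finite_keys order_refl, of f] partial_def ceval_sum
        ceval_single mult_ac)
qed

lemma matrix_vector_mult_axis:
  fixes M :: "complex ^ 'n ^ 'm"
  shows "(M *v axis k 1) $ i = M $ i $ k"
  by (simp add: matrix_vector_mult_def axis_def if_distrib cong: if_cong)

lemma matrix_vector_mult_add_axis:
  fixes M :: "complex ^ 'n ^ 'm"
  shows "(M *v (x + s *s axis k 1)) $ i = (M *v x) $ i + s * M $ i $ k"
  by (simp add: matrix_vector_right_distrib vector_scalar_commute matrix_vector_mult_axis)

text \<open>Coefficients and exponent are arbitrary, so the rule also applies to its own result and
  yields second derivatives.\<close>

lemma DERIV_diagonal_form:
  fixes M :: "complex ^ 'n ^ 'm"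
  shows "((\<lambda>s. \<Sum>i\<in>UNIV. lam i * ((M *v (x + s *s axis k 1)) $ i) ^ d) has_field_derivative
    (\<Sum>i\<in>UNIV. of_nat d * lam i * M $ i $ k * ((M *v x) $ i) ^ (d - 1))) (at 0)"
  unfolding matrix_vector_mult_add_axis
  by (auto intro!: derivative_eq_intros sum.cong)

lemma invertible_solve:
  fixes M :: "complex ^ 'n ^ 'n"
  assumes "invertible M"
  obtains x where "M *v x = y"
  by (metis assms invertible_def matrix_vector_mul_assoc matrix_vector_mul_lid)

text \<open>If \<open>lam i = 0\<close>, the preimage of the unit vector \<open>axis i 1\<close>
  under \<open>M\<close> is a nonzero common zero of the partials: every other summand carries the
  factor \<open>0 ^ (d - 1)\<close>.\<close>

lemma smooth_diag_sum_nonzero: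
  assumes "smooth (diag_sum d lam M)" "invertible M" "d \<ge> 2"
  shows "lam i \<noteq> 0"
proof
  assume lam: "lam i = 0"
  obtain x where x: "M *v x = axis i 1"
    using invertible_solve[OF assms(2)] .
  have "ceval (partial k (diag_sum d lam M)) x = 0" for k
  proof -
    have "ceval (partial k (diag_sum d lam M)) x =
      (\<Sum>i\<in>UNIV. of_nat d * lam i * M $ i $ k * ((M *v x) $ i) ^ (d - 1))"
      by (rule DERIV_unique[OF ceval_partial])
        (unfold ceval_diag_sum, rule DERIV_diagonal_form)
    also have "\<dots> = 0"
      by (rule sum.neutral) (use lam assms(3) in \<open>auto simp: x axis_def\<close>)
    finally show ?thesis .
  qed
  then have "x = 0"
    using assms(1) by (auto simp: smooth_def)
  with x show False
    by (metis axis_eq_0_iff matrix_vector_mult_0_right one_neq_zero)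
qed

section \<open>Rigidity of diagonal representations\<close>

lemma diagonal_form_rows:
  fixes A :: "complex ^ 'n ^ 'n"
  assumes eq: "\<And>y. (\<Sum>i\<in>UNIV. \<alpha> i * (y $ i) ^ d) = (\<Sum>i\<in>UNIV. lam i * ((A *v y) $ i) ^ d)"
    and A: "invertible A" and lam: "\<And>i. lam i \<noteq> 0" and d: "d \<ge> 3" and "j \<noteq> k"
  shows "A $ i $ j * A $ i $ k = 0"
proof -
  have grad: "(\<Sum>i\<in>UNIV. of_nat d * lam i * A $ i $ j * ((A *v y) $ i) ^ (d - 1)) =
      of_nat d * \<alpha> j * (y $ j) ^ (d - 1)" for y
  proof -
    \<comment> \<open>The left side of \<open>eq\<close> is itself a diagonal form, with matrix
      \<open>mat 1\<close>, so \<open>DERIV_diagonal_form\<close> differentiates both sides.\<close>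
    have "(\<Sum>i\<in>UNIV. of_nat d * lam i * A $ i $ j * ((A *v y) $ i) ^ (d - 1)) =
        (\<Sum>i\<in>UNIV. of_nat d * \<alpha> i * (mat 1 :: complex ^ 'n ^ 'n) $ i $ j *
          ((mat 1 *v y) $ i) ^ (d - 1))"
    proof (rule DERIV_unique[OF DERIV_diagonal_form])
      have "(\<Sum>i\<in>UNIV. lam i * ((A *v x) $ i) ^ d) = (\<Sum>i\<in>UNIV. \<alpha> i * ((mat 1 *v x) $ i) ^ d)" for x
        by (simp add: eq)
      then show "((\<lambda>s. \<Sum>i\<in>UNIV. lam i * ((A *v (y + s *s axis j 1)) $ i) ^ d) has_field_derivative
          (\<Sum>i\<in>UNIV. of_nat d * \<alpha> i * (mat 1 :: complex ^ 'n ^ 'n) $ i $ j *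
            ((mat 1 *v y) $ i) ^ (d - 1))) (at 0)"
        by (simp only: DERIV_diagonal_form)
    qed
    also have "\<dots> = (\<Sum>i\<in>UNIV. if i = j then of_nat d * \<alpha> i * (y $ i) ^ (d - 1) else 0)"
      unfolding matrix_vector_mul_lid by (rule sum.cong) (auto simp: mat_def)
    finally show ?thesis by simp
  qed
  obtain y where y: "A *v y = axis i 1"
    using invertible_solve[OF A] .
  let ?b = "\<lambda>i. of_nat d * lam i * A $ i $ j"
  let ?D = "\<Sum>i\<in>UNIV. of_nat (d - 1) * ?b i * A $ i $ k * ((A *v y) $ i) ^ (d - 1 - 1)"
  \<comment> \<open>By \<open>grad\<close> the derivative along axis \<open>j\<close> depends on
    \<open>y $ j\<close> alone, so it is constant along axis \<open>k\<close>. Its derivative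
    \<open>?D\<close> along that axis therefore vanishes.\<close>
  have "(y + s *s axis k 1) $ j = y $ j" for s
    using \<open>j \<noteq> k\<close> by (simp add: axis_def)
  then have "((\<lambda>s. of_nat d * \<alpha> j * (y $ j) ^ (d - 1)) has_field_derivative ?D) (at 0)"
    using DERIV_diagonal_form[of ?b A y k "d - 1"] by (simp only: grad)
  then have "0 = ?D"
    using DERIV_unique[OF DERIV_const] by blast
  \<comment> \<open>Here \<open>d \<ge> 3\<close> enters: the exponent \<open>d - 2\<close> is
    positive, so the zero coordinates of \<open>axis i 1\<close> remove all summands but
    one.\<close>
  also have "\<dots> = (\<Sum>l\<in>UNIV. if l = i then of_nat (d - 1) * ?b l * A $ l $ k else 0)"
    by (rule sum.cong) (use d in \<open>auto simp: y axis_def\<close>)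
  also have "\<dots> = of_nat (d - 1) * ?b i * A $ i $ k"
    by simp
  finally show ?thesis
    using d lam[of i] by auto
qed

text \<open>A zero row would keep a unit vector out of the range, so each row has a nonzero entry,
  unique by \<open>rows\<close>. A zero column would put a unit vector into the kernel, so
  \<open>\<sigma>\<close> is surjective, hence bijective by finiteness.\<close>

lemma invertible_monomial:
  fixes A :: "complex ^ 'n ^ 'n"
  assumes A: "invertible A" and rows: "\<And>i j k. j \<noteq> k \<Longrightarrow> A $ i $ j * A $ i $ k = 0"
  obtains \<sigma> where "bij \<sigma>" "\<And>i. A $ i $ \<sigma> i \<noteq> 0" "\<And>i j. j \<noteq> \<sigma> i \<Longrightarrow> A $ i $ j = 0"
proof -
  have "\<exists>j. A $ i $ j \<noteq> 0" for i
  proof (rule ccontr)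
    assume *: "\<nexists>j. A $ i $ j \<noteq> 0"
    obtain x where "A *v x = axis i 1"
      using invertible_solve[OF A] .
    then have "(A *v x) $ i = 1"
      by simp
    then show False
      using * by (simp add: matrix_vector_mult_def)
  qed
  then obtain \<sigma> where \<sigma>: "\<And>i. A $ i $ \<sigma> i \<noteq> 0"
    by metis
  have zero: "A $ i $ j = 0" if "j \<noteq> \<sigma> i" for i j
    using rows[OF that, of i] \<sigma>[of i] by simp
  have "\<exists>i. \<sigma> i = j" for j
  proof (rule ccontr)
    assume "\<nexists>i. \<sigma> i = j"
    then have "A $ i $ j = 0" for i
      using zero[of j i] by metis
    then have "A *v axis j 1 = 0"
      by (simp add: matrix_vector_mult_axis vec_eq_iff)
    then show False
      using A by (metis axis_eq_0_iff invertible_def matrix_vector_mul_assoc matrix_vector_mul_lid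
          matrix_vector_mult_0_right one_neq_zero)
  qed
  then have "surj \<sigma>"
    by (metis surjI)
  then have "bij \<sigma>"
    by (simp add: bij_betw_def finite_UNIV_surj_inj)
  with \<sigma> zero show thesis
    using that by blast
qed

lemma diag_sum_unique:
  fixes P Q :: "complex ^ 'n ^ 'n"
  assumes eq: "diag_sum d \<alpha> P = diag_sum d lam Q"
    and smooth: "smooth (diag_sum d \<alpha> P)" and P: "invertible P" and Q: "invertible Q" and d: "d \<ge> 3"
  obtains c \<sigma> where "bij \<sigma>" "\<And>i. c i \<noteq> 0" "\<And>i. scale_rows c P $ \<sigma> i = Q $ i"
proof -
  obtain P' where PP: "P ** P' = mat 1" "P' ** P = mat 1"
    using P by (auto simp: invertible_def)
  define A where "A = Q ** P'"
  have A: "invertible A"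
    unfolding A_def by (intro invertible_mult Q) (use PP in \<open>auto simp: invertible_def\<close>)
  have QA: "Q = A ** P"
    by (simp add: A_def PP flip: matrix_mul_assoc)
  \<comment> \<open>Evaluating at \<open>P' *v y\<close> turns \<open>P\<close> into the identity
    and \<open>Q\<close> into \<open>A\<close>.\<close>
  have "(\<Sum>i\<in>UNIV. \<alpha> i * (y $ i) ^ d) = (\<Sum>i\<in>UNIV. lam i * ((A *v y) $ i) ^ d)" for y
    using arg_cong[OF eq, of "\<lambda>f. ceval f (P' *v y)"]
    by (simp add: ceval_diag_sum matrix_vector_mul_assoc PP A_def)
  moreover have "lam i \<noteq> 0" for i
    using smooth_diag_sum_nonzero[of d lam Q] smooth eq Q d by simp
  ultimately have rows: "A $ i $ j * A $ i $ k = 0" if "j \<noteq> k" for i j k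
    using diagonal_form_rows[OF _ A _ d that] by blast
  obtain \<sigma> where \<sigma>: "bij \<sigma>" "\<And>i. A $ i $ \<sigma> i \<noteq> 0" "\<And>i j. j \<noteq> \<sigma> i \<Longrightarrow> A $ i $ j = 0"
    using invertible_monomial[OF A rows] by metis
  \<comment> \<open>The scalars are indexed by the rows of \<open>P\<close>, that is, by the columns
    of \<open>A\<close>: \<open>c j\<close> is the only nonzero entry of column
    \<open>j\<close>.\<close>
  define c where "c j = A $ inv \<sigma> j $ j" for j
  have c\<sigma>: "c (\<sigma> i) = A $ i $ \<sigma> i" for i
    using \<sigma>(1) by (simp add: c_def bij_is_inj)
  have "c j \<noteq> 0" for j
    using \<sigma>(2)[of "inv \<sigma> j"] surj_f_inv_f[OF bij_is_surj[OF \<sigma>(1)], of j]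
    unfolding c_def by simp
  moreover have "scale_rows c P $ \<sigma> i = Q $ i" for i
  proof -
    have "(A ** P) $ i $ j = c (\<sigma> i) * P $ \<sigma> i $ j" for j
    proof -
      have "(A ** P) $ i $ j = (\<Sum>k\<in>UNIV. if k = \<sigma> i then A $ i $ k * P $ k $ j else 0)"
        unfolding matrix_matrix_mult_def vec_lambda_beta by (rule sum.cong) (auto simp: \<sigma>(3))
      then show ?thesis
        by (simp add: c\<sigma>)
    qed
    then show ?thesis
      unfolding QA by (simp add: scale_rows_def vec_eq_iff)
  qed
  ultimately show thesis
    by (rule that[OF \<sigma>(1)])
qed

section \<open>Row scaling, row permutation and Gram matrices\<close>

text \<open>The factor \<open>c i ^ d\<close> that leaves the power is absorbed by the
  coefficient.\<close>

lemma diag_sum_scale_rows: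
  assumes "\<And>i. c i \<noteq> 0"
  shows "diag_sum d (\<lambda>i. \<alpha> i / c i ^ d) (scale_rows c P) = diag_sum d \<alpha> P"
proof -
  have mult: "cconst (a * b) = (cconst a * cconst b :: 'a cpoly)" for a b
    by (simp add: cconst_def mult_single)
  have pow: "cconst (a ^ k) = (cconst a ^ k :: 'a cpoly)" for a k
    by (induction k) (simp_all add: mult, simp add: cconst_def)
  have "cconst (\<alpha> i / c i ^ d) * (\<Sum>j\<in>UNIV. cconst (c i * P $ i $ j) * cvar j) ^ d =
      cconst (\<alpha> i) * (\<Sum>j\<in>UNIV. cconst (P $ i $ j) * cvar j) ^ d" for i
  proof -
    have "(\<Sum>j\<in>UNIV. cconst (c i * P $ i $ j) * cvar j) =
        cconst (c i) * (\<Sum>j\<in>UNIV. cconst (P $ i $ j) * cvar j)"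
      by (simp add: mult sum_distrib_left mult.assoc)
    moreover have "cconst (\<alpha> i) = (cconst (\<alpha> i / c i ^ d) * cconst (c i) ^ d :: 'a cpoly)"
      using assms by (simp flip: mult pow)
    ultimately show ?thesis
      by (simp add: power_mult_distrib mult.assoc)
  qed
  then show ?thesis
    by (simp add: diag_sum_def scale_rows_def)
qed

text \<open>Each entry of the product is a sum over the rows, which \<open>\<sigma>\<close> merely
  reindexes.\<close>

lemma row_permutation_gram:
  fixes R Q :: "complex ^ 'n ^ 'n"
  assumes "bij \<sigma>" "\<And>i. R $ \<sigma> i = Q $ i"
  shows "transpose (map_matrix g R) ** R = transpose (map_matrix g Q) ** Q"
proof -
  have "(\<Sum>m\<in>UNIV. g (R $ m $ j) * R $ m $ k) = (\<Sum>i\<in>UNIV. g (Q $ i $ j) * Q $ i $ k)" for j k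
    using sum.reindex_bij_betw[OF assms(1), of "\<lambda>m. g (R $ m $ j) * R $ m $ k"]
    by (simp add: assms(2))
  then show ?thesis
    by (simp add: vec_eq_iff matrix_matrix_mult_def transpose_def map_matrix_def)
qed

text \<open>Orthogonality is the case \<open>g = id\<close>, unitarity the case \<open>g = cnj\<close>.\<close>

lemma gram_diagonalizable_iff:
  fixes P :: "complex ^ 'n ^ 'n"
  assumes "d \<ge> 3" "smooth (diag_sum d \<alpha> P)" "invertible P"
  shows "(\<exists>Q lam. transpose (map_matrix g Q) ** Q = mat 1 \<and> diag_sum d \<alpha> P = diag_sum d lam Q) \<longleftrightarrow>
    (\<exists>c. (\<forall>i. c i \<noteq> 0) \<and>
      transpose (map_matrix g (scale_rows c P)) ** scale_rows c P = mat 1)" (is "?L \<longleftrightarrow> ?R")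
proof
  assume ?L
  then obtain Q lam where Q: "transpose (map_matrix g Q) ** Q = mat 1"
    and eq: "diag_sum d \<alpha> P = diag_sum d lam Q"
    by blast
  have "invertible Q"
    using Q invertible_left_inverse by blast
  obtain c \<sigma> where \<sigma>: "bij \<sigma>" and c: "\<And>i. c i \<noteq> 0"
    and rows: "\<And>i. scale_rows c P $ \<sigma> i = Q $ i"
    using diag_sum_unique[OF eq assms(2,3) \<open>invertible Q\<close> assms(1)] by metis
  show ?R
    using c row_permutation_gram[OF \<sigma> rows, of g] Q by auto
next
  assume ?R
  then obtain c where c: "\<And>i. c i \<noteq> 0"
    and gram: "transpose (map_matrix g (scale_rows c P)) ** scale_rows c P = mat 1"
    by blast
  show ?L
    by (intro exI[of _ "scale_rows c P"] exI[of _ "\<lambda>i. \<alpha> i / c i ^ d"] conjI gram)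
      (rule diag_sum_scale_rows[OF c, symmetric])
qed

theorem corollary4p4:
  fixes f :: "('n::finite) cpoly"
    and P :: "complex ^ 'n ^ 'n"
    and \<alpha> :: "'n \<Rightarrow> complex"
    and d :: nat
  assumes "d \<ge> 3"
    and "form d f"
    and "smooth f"
    and "diagonalizable d f"
    and "invertible P"
    and "f = (\<Sum>i\<in>UNIV. cconst (\<alpha> i) * (\<Sum>j\<in>UNIV. cconst (P $ i $ j) * cvar j) ^ d)"
  shows "(orthogonally_diagonalizable d f \<longleftrightarrow>
            (\<exists>c. (\<forall>i. c i \<noteq> 0) \<and> orthogonal_matrix (scale_rows c P))) \<and>
         (unitarily_diagonalizable d f \<longleftrightarrow>
            (\<exists>c. (\<forall>i. c i \<noteq> 0) \<and> unitary_matrix (scale_rows c P)))"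
proof -
  have f: "f = diag_sum d \<alpha> P"
    using assms(6) by (simp add: diag_sum_def)
  \<comment> \<open>The identity map in place of \<open>cnj\<close> brings orthogonality into the
    shape that \<open>gram_diagonalizable_iff\<close> shares with unitarity.\<close>
  have "orthogonal_matrix Q \<longleftrightarrow> transpose (map_matrix (\<lambda>z. z) Q) ** Q = mat 1"
    for Q :: "complex ^ 'n ^ 'n"
    by (simp add: orthogonal_matrix_complex_iff map_matrix_def)
  then show ?thesis
    using gram_diagonalizable_iff[OF assms(1) assms(3)[unfolded f] assms(5)] assms(4)
    by (simp add: orthogonally_diagonalizable_def unitarily_diagonalizable_def unitary_matrix_def f)
qed

end
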